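(* Let $a_n$ ($n\in\mathbb{Z}$) and $b_m$ ($m\in\mathbb{Z}$) be non-zero real numbers with $a_n\ne b_m$ for all $n,m$, and let $\lambda$ be a non-zero real constant with $1/\lambda\neq a_n$, $1/\lambda\ne b_m$ for all $n,m$. Let $\gamma_n^m$ be a discrete motion of a discrete curve with potential function $\Theta_n^m$. Let $\widetilde\Theta_n^m$ be a Bäcklund transform of $\Theta_n^m$, i.e. a real function on $\mathbb{Z}^2$ satisfying $$\tan\left(\frac{\widetilde\Theta_{n+1}^m-\Theta_n^m}{4}\right)=\frac{\frac1\lambda+a_n}{\frac1\lambda-a_n}\tan\left(\frac{\widetilde\Theta_n^m-\Theta_{n+1}^m}{4}\right),$$ $$\tan\left(\frac{\widetilde\Theta_n^{m+1}-\Theta_n^m}{4}\right)=\frac{\frac1\lambda+b_m}{\frac1\lambda-b_m}\tan\left(\frac{\widetilde\Theta_n^m-\Theta_n^{m+1}}{4}\right).$$ Then $$\widetilde\gamma_n^m=\gamma_n^m+\frac1\lambda\,R\left(\frac{\widetilde\Theta_n^m-\Theta_{n+1}^m}{2}\right)\frac{\gamma_{n+1}^m-\gamma_n^m}{a_n}$$ is a discrete motion of a discrete curve with potential function $\widetilde\Theta_n^m$.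
   Context: $R(\phi)=\begin{pmatrix}\cos\phi&-\sin\phi\\ \sin\phi&\cos\phi\end{pmatrix}$. A map $\gamma:\mathbb{Z}^2\to\mathbb{R}^2$, $(n,m)\mapsto\gamma_n^m$, is a discrete motion of a discrete curve (with respect to $a_n,b_m$) with potential function $\Theta_n^m\in\mathbb{R}$ if for all $n,m$ $$\left|\frac{\gamma_{n+1}^m-\gamma_n^m}{a_n}\right|=1,\qquad \frac{\gamma_{n+1}^m-\gamma_n^m}{a_n}=R(K_n^m)\frac{\gamma_n^m-\gamma_{n-1}^m}{a_{n-1}},\qquad \frac{\gamma_n^{m+1}-\gamma_n^m}{b_m}=R(W_n^m)\frac{\gamma_{n+1}^m-\gamma_n^m}{a_n},$$ with $W_n^m=\frac{\Theta_n^{m+1}-\Theta_{n+1}^m}{2}$, $K_n^m=\frac{\Theta_{n+1}^m-\Theta_{n-1}^m}{2}$, and the potential is normalized so that the angle function is $\Psi_n^m=\frac{\Theta_{n+1}^m+\Theta_n^m}{2}$, i.e. $\frac{\gamma_{n+1}^m-\gamma_n^m}{a_n}={}^t(\cos\Psi_n^m,\sin\Psi_n^m)$. (Then $\Theta_n^m$ satisfies the discrete potential mKdV equation $\tan\frac{\Theta_{n+1}^{m+1}-\Theta_n^m}{4}=\frac{b_m+a_n}{b_m-a_n}\tan\frac{\Theta_n^{m+1}-\Theta_{n+1}^m}{4}$.) An equation $\tan\alpha=\frac{p+q}{p-q}\tan\beta$ with $p\ne q$ is understood in the cross-multiplied form $(p-q)\sin\alpha\cos\beta=(p+q)\cos\alpha\sin\beta$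 if a tangent is undefined. *)

theory Defs
  imports "HOL-Analysis.Analysis"
begin

definition rot :: "real \<Rightarrow> real^2^2" where
  "rot \<phi> = vector [vector [cos \<phi>, - sin \<phi>], vector [sin \<phi>, cos \<phi>]]"

(* In "\<gamma> n m" and "\<Theta> n m" the first argument is the lower (curve) index, the second the
   upper (time) index.  The last clause normalizes the potential \<Theta> by prescribing the angle function \<Psi>. *)
definition discrete_motion ::
  "(int \<Rightarrow> real) \<Rightarrow> (int \<Rightarrow> real) \<Rightarrow> (int \<Rightarrow> int \<Rightarrow> real^2) \<Rightarrow> (int \<Rightarrow> int \<Rightarrow> real) \<Rightarrow> bool"
where
  "discrete_motion a b \<gamma> \<Theta> \<longleftrightarrow> (\<forall>n m.
     (let K = (\<Theta> (n + 1) m - \<Theta> (n - 1) m) / 2;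
          W = (\<Theta> n (m + 1) - \<Theta> (n + 1) m) / 2;
          \<Psi> = (\<Theta> (n + 1) m + \<Theta> n m) / 2
      in norm ((\<gamma> (n + 1) m - \<gamma> n m) /\<^sub>R a n) = 1 \<and>
         (\<gamma> (n + 1) m - \<gamma> n m) /\<^sub>R a n
           = rot K *v ((\<gamma> n m - \<gamma> (n - 1) m) /\<^sub>R a (n - 1)) \<and>
         (\<gamma> n (m + 1) - \<gamma> n m) /\<^sub>R b m
           = rot W *v ((\<gamma> (n + 1) m - \<gamma> n m) /\<^sub>R a n) \<and>
         (\<gamma> (n + 1) m - \<gamma> n m) /\<^sub>R a n = vector [cos \<Psi>, sin \<Psi>]))"

(* The equation tan A = (p + q) / (p - q) * tan B for p \<noteq> q, cross-multiplied when a tangent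
   is undefined (the library's tan is total, with value 0 at its poles). *)
definition tan_relation :: "real \<Rightarrow> real \<Rightarrow> real \<Rightarrow> real \<Rightarrow> bool" where
  "tan_relation p q \<alpha> \<beta> \<longleftrightarrow>
     (if cos \<alpha> \<noteq> 0 \<and> cos \<beta> \<noteq> 0
      then tan \<alpha> = (p + q) / (p - q) * tan \<beta>
      else (p - q) * sin \<alpha> * cos \<beta> = (p + q) * cos \<alpha> * sin \<beta>)"

definition backlund_transform ::
  "(int \<Rightarrow> real) \<Rightarrow> (int \<Rightarrow> real) \<Rightarrow> real \<Rightarrow> (int \<Rightarrow> int \<Rightarrow> real) \<Rightarrow> (int \<Rightarrow> int \<Rightarrow> real) \<Rightarrow> bool"
where
  "backlund_transform a b lam \<Theta> \<Theta>' \<longleftrightarrow> (\<forall>n m.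
     tan_relation (1 / lam) (a n)
       ((\<Theta>' (n + 1) m - \<Theta> n m) / 4) ((\<Theta>' n m - \<Theta> (n + 1) m) / 4) \<and>
     tan_relation (1 / lam) (b m)
       ((\<Theta>' n (m + 1) - \<Theta> n m) / 4) ((\<Theta>' n m - \<Theta> n (m + 1)) / 4))"

end

(* Identify R^2 with the complex plane. A discrete motion with potential \<Theta> is the same as a
   map whose increments are a_n e^(i(\<Theta>_(n+1)^m + \<Theta>_n^m)/2) in n and
   b_m e^(i(\<Theta>_n^(m+1) + \<Theta>_n^m)/2) in m, a form that is symmetric in the two directions.
   The transformed curve is \<gamma> + (1/\<lambda>) e^(i(\<Theta>' + \<Theta>)/2), so in each direction the claim is the
   identity p (e^(i(w+y)/2) - e^(i(z+x)/2)) = q (e^(i(w+z)/2) - e^(i(x+y)/2)) with p = 1/\<lambda>,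
   where x, y are the values of \<Theta> and z, w those of \<Theta>' at the ends of an edge of length q.
   Dividing by 2i e^(i(x+y+z+w)/4) and putting \<alpha> = (w-x)/4, \<beta> = (z-y)/4 turns it into
   p sin(\<alpha>-\<beta>) = q sin(\<alpha>+\<beta>), which is the Baecklund relation. *)
theory Submission
  imports Defs
begin

definition unit_vec :: "real \<Rightarrow> real^2" where
  "unit_vec \<psi> = vector [cos \<psi>, sin \<psi>]"

lemma unit_vec_nth [simp]: "unit_vec \<psi> $ 1 = cos \<psi>" "unit_vec \<psi> $ 2 = sin \<psi>"
  by (simp_all add: unit_vec_def)

lemma norm_unit_vec [simp]: "norm (unit_vec \<psi>) = 1"
  by (simp add: norm_vec_def L2_set_def sum_2)

lemma rot_unit_vec [simp]: "rot \<phi> *v unit_vec \<psi> = unit_vec (\<phi> + \<psi>)"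
  by (simp add: vec_eq_iff forall_2 rot_def matrix_vector_mult_def sum_2 cos_add sin_add)

text \<open>Rotations add angles. In W + \<Psi> the term \<open>\<Theta> (n + 1) m\<close> cancels,
  and K added to the angle of the preceding edge gives \<Psi>, which yields the rotation clauses
  from the two increments.\<close>

lemma discrete_motion_iff:
  assumes "\<And>n. a n \<noteq> 0" and "\<And>m. b m \<noteq> 0"
  shows "discrete_motion a b \<gamma> \<Theta> \<longleftrightarrow>
    (\<forall>n m. \<gamma> (n + 1) m - \<gamma> n m = a n *\<^sub>R unit_vec ((\<Theta> (n + 1) m + \<Theta> n m) / 2) \<and>
           \<gamma> n (m + 1) - \<gamma> n m = b m *\<^sub>R unit_vec ((\<Theta> n (m + 1) + \<Theta> n m) / 2))"
    (is "_ \<longleftrightarrow> (\<forall>n m. ?T n m \<and> ?N n m)")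
proof
  assume L: "discrete_motion a b \<gamma> \<Theta>"
  show "\<forall>n m. ?T n m \<and> ?N n m"
  proof (intro allI)
    fix n m
    have T: "(\<gamma> (n + 1) m - \<gamma> n m) /\<^sub>R a n = unit_vec ((\<Theta> (n + 1) m + \<Theta> n m) / 2)"
      and N: "(\<gamma> n (m + 1) - \<gamma> n m) /\<^sub>R b m
        = rot ((\<Theta> n (m + 1) - \<Theta> (n + 1) m) / 2) *v ((\<gamma> (n + 1) m - \<gamma> n m) /\<^sub>R a n)"
      using L unfolding discrete_motion_def Let_def unit_vec_def by blast+
    have "(\<gamma> n (m + 1) - \<gamma> n m) /\<^sub>R b m = unit_vec ((\<Theta> n (m + 1) + \<Theta> n m) / 2)"
      unfolding N T by (simp flip: add_divide_distrib)
    then have "b m *\<^sub>R ((\<gamma> n (m + 1) - \<gamma> n m) /\<^sub>R b m)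
        = b m *\<^sub>R unit_vec ((\<Theta> n (m + 1) + \<Theta> n m) / 2)"
      by simp
    moreover have "a n *\<^sub>R ((\<gamma> (n + 1) m - \<gamma> n m) /\<^sub>R a n)
        = a n *\<^sub>R unit_vec ((\<Theta> (n + 1) m + \<Theta> n m) / 2)"
      using T by simp
    ultimately show "?T n m \<and> ?N n m"
      using assms by simp
  qed
next
  assume "\<forall>n m. ?T n m \<and> ?N n m"
  then have T: "\<gamma> (n + 1) m - \<gamma> n m = a n *\<^sub>R unit_vec ((\<Theta> (n + 1) m + \<Theta> n m) / 2)"
    and N: "\<gamma> n (m + 1) - \<gamma> n m = b m *\<^sub>R unit_vec ((\<Theta> n (m + 1) + \<Theta> n m) / 2)" for n m
    by auto
  \<comment> \<open>The clause for K contains the preceding edge in this form, which the pattern of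
    \<open>T\<close> does not match.\<close>
  have T': "\<gamma> n m - \<gamma> (n - 1) m = a (n - 1) *\<^sub>R unit_vec ((\<Theta> n m + \<Theta> (n - 1) m) / 2)" for n m
    using T[of "n - 1" m] by simp
  show "discrete_motion a b \<gamma> \<Theta>"
    unfolding discrete_motion_def Let_def unit_vec_def[symmetric] T N T'
    using assms by (simp flip: add_divide_distrib)
qed

lemma tan_relation_cross_multiplied:
  assumes "tan_relation p q \<alpha> \<beta>" and "p \<noteq> q"
  shows "(p - q) * sin \<alpha> * cos \<beta> = (p + q) * cos \<alpha> * sin \<beta>"
  using assms by (auto simp: tan_relation_def tan_def field_simps split: if_splits)

text \<open>A chord of the unit circle is perpendicular to the direction s bisecting its endpoints.
  Chords with the same s are therefore parallel and compare through a single scalar.\<close>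

lemma unit_vec_diff:
  "unit_vec (s + t) - unit_vec (s - t) = (2 * sin t) *\<^sub>R vector [- sin s, cos s]"
  by (simp add: vec_eq_iff forall_2 cos_add cos_diff sin_add sin_diff)

lemma tan_relation_unit_vec:
  assumes "tan_relation p q ((w - x) / 4) ((z - y) / 4)" and "p \<noteq> q"
  shows "p *\<^sub>R (unit_vec ((w + y) / 2) - unit_vec ((z + x) / 2))
       = q *\<^sub>R (unit_vec ((w + z) / 2) - unit_vec ((y + x) / 2))"
proof -
  define s \<alpha> \<beta> where "s = (x + y + z + w) / 4" and "\<alpha> = (w - x) / 4" and "\<beta> = (z - y) / 4"
  have "p * sin (\<alpha> - \<beta>) = q * sin (\<alpha> + \<beta>)"
    using tan_relation_cross_multiplied[OF assms]
    by (simp add: \<alpha>_def \<beta>_def sin_add sin_diff algebra_simps)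
  then have eq: "p * (2 * sin (\<alpha> - \<beta>)) = q * (2 * sin (\<alpha> + \<beta>))"
    by simp
  \<comment> \<open>Both chords have the mean angle s, so the vector identity reduces to
    \<open>eq\<close>.\<close>
  have angles: "(w + y) / 2 = s + (\<alpha> - \<beta>)" "(z + x) / 2 = s - (\<alpha> - \<beta>)"
      "(w + z) / 2 = s + (\<alpha> + \<beta>)" "(y + x) / 2 = s - (\<alpha> + \<beta>)"
    by (simp_all add: s_def \<alpha>_def \<beta>_def field_simps)
  show ?thesis
    by (simp only: angles unit_vec_diff scaleR_scaleR eq)
qed

theorem proposition4p5:
  fixes a b :: "int \<Rightarrow> real" and lam :: real
    and \<gamma> \<gamma>' :: "int \<Rightarrow> int \<Rightarrow> real^2"
    and \<Theta> \<Theta>' :: "int \<Rightarrow> int \<Rightarrow> real"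
  assumes "\<And>n. a n \<noteq> 0" and "\<And>m. b m \<noteq> 0"
    and "\<And>n m. a n \<noteq> b m"
    and "lam \<noteq> 0"
    and "\<And>n. 1 / lam \<noteq> a n" and "\<And>m. 1 / lam \<noteq> b m"
    and "discrete_motion a b \<gamma> \<Theta>"
    and "backlund_transform a b lam \<Theta> \<Theta>'"
    and "\<And>n m. \<gamma>' n m = \<gamma> n m + (1 / lam) *\<^sub>R
           (rot ((\<Theta>' n m - \<Theta> (n + 1) m) / 2) *v ((\<gamma> (n + 1) m - \<gamma> n m) /\<^sub>R a n))"
  shows "discrete_motion a b \<gamma>' \<Theta>'"
proof -
  note nz = assms(1,2)
  note motion = assms(7)[unfolded discrete_motion_iff[OF nz], rule_format]
  note backlund = assms(8)[unfolded backlund_transform_def, rule_format]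
  \<comment> \<open>The angle \<open>\<Theta> (n + 1) m\<close> cancels, so the offset no longer
    favours the n direction.\<close>
  have \<gamma>': "\<gamma>' n m = \<gamma> n m + (1 / lam) *\<^sub>R unit_vec ((\<Theta>' n m + \<Theta> n m) / 2)" for n m
    using assms(1) by (simp add: assms(9) motion flip: add_divide_distrib)
  \<comment> \<open>The change of the offset is the new edge minus the old one, and the old one
    cancels against the increment of \<gamma>.\<close>
  have "\<gamma>' (n + 1) m - \<gamma>' n m = a n *\<^sub>R unit_vec ((\<Theta>' (n + 1) m + \<Theta>' n m) / 2)" for n m
    using motion[of n m] tan_relation_unit_vec[OF backlund[of n m, THEN conjunct1] assms(5)]
    by (simp add: \<gamma>' algebra_simps)
  moreover have "\<gamma>' n (m + 1) - \<gamma>' n m = b m *\<^sub>R unit_vec ((\<Theta>' n (m + 1) + \<Theta>' n m) / 2)" for n m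
    using motion[of n m] tan_relation_unit_vec[OF backlund[of n m, THEN conjunct2] assms(6)]
    by (simp add: \<gamma>' algebra_simps)
  ultimately show ?thesis
    by (simp add: discrete_motion_iff[OF nz])
qed

end
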